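(* Let $f$ be $\sigma_{\mathrm f}$-strongly convex, $U$ closed convex, and suppose the set $X^*$ of optimal multipliers of the linearly constrained problem (L) is nonempty. Let $(x^k,u^k)_{k\ge0}$ be generated by Algorithm (DG) with $\alpha_k=1/L_{\mathrm d}$. Then the last primal iterate $u^{2k}$ is an $\epsilon$-primal solution of (L) after $2k=\mathcal{O}(1/\epsilon)$ iterations; that is, there exist constants $C_1,C_2>0$, independent of $\epsilon$ and $k$, such that for every $\epsilon>0$ and every integer $k\ge1$ with $2k\ge C_1/\epsilon$, $$\|Gu^{2k}+g\|\le C_2\,\epsilon \quad\text{and}\quad -C_2\,\epsilon\le f(u^{2k})-f^*\le C_2\,\epsilon .$$
   Context: Problem (L): $f^*=\min_{u\in U}f(u)$ subject to $Gu+g=0$, where $f:\mathbb{R}^n\to\mathbb{R}$ is $\sigma_{\mathrm f}$-strongly convex with respect to the Euclidean norm $\|\cdot\|$ ($\sigma_{\mathrm f}>0$), $G\in\mathbb{R}^{p\times n}$ ($G\neq0$), $g\in\mathbb{R}^p$, and $U\subseteq\mathbb{R}^n$ is a nonempty closed convex set. The Lagrangian is $\mathcal{L}(u,x)=f(u)-\langle x,Gu+g\rangle$, the dual function is $d(x)=\min_{u\in U}\mathcal{L}(u,x)$ for $x\in\mathbb{R}^p$, and $u(x)$ is the unique minimizer of $\mathcal{L}(\cdot,x)$ over $U$. The function $d$ is concave and differentiable with $\nabla d(x)=-Gu(x)-g$, Lipschitz with constant $L_{\mathrm d}=\|G\|^2/\sigma_{\mathrm f}$ ($\|G\|$ the spectral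 norm). The dual problem is unconstrained; there exists a finite optimal Lagrange multiplier, so that $f^*=\max_{x\in\mathbb{R}^p}d(x)$ and the set $X^*$ of maximizers is nonempty. Algorithm (DG) with constant step size: given $x^0\in\mathbb{R}^p$, for $k\ge0$ compute $u^k=u(x^k)=\arg\min_{u\in U}\mathcal{L}(u,x^k)$ and $x^{k+1}=x^k+\frac1{L_{\mathrm d}}\nabla d(x^k)$. $\tilde u\in U$ is an $\epsilon$-primal solution if $\|G\tilde u+g\|\le\mathcal{O}(\epsilon)$ and $-\mathcal{O}(\epsilon)\le f(\tilde u)-f^*\le\mathcal{O}(\epsilon)$; constants in $\mathcal{O}$ may depend on the problem data and $x^0$, but not on $\epsilon$ or $k$. *)

theory Defs
  imports "HOL-Analysis.Analysis"
begin

definition strongly_convex :: "real \<Rightarrow> ('a::real_normed_vector \<Rightarrow> real) \<Rightarrow> bool" where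
  "strongly_convex \<sigma> f \<longleftrightarrow>
     (\<forall>u v. \<forall>t\<in>{0..1}.
        f ((1 - t) *\<^sub>R u + t *\<^sub>R v)
          \<le> (1 - t) * f u + t * f v - \<sigma> / 2 * t * (1 - t) * (norm (u - v))\<^sup>2)"

text \<open>
  The minima defining the optimal value and the dual function are written as infima of sets of
  reals. For strongly convex \<open>f\<close> and nonempty closed \<open>U\<close> both infima are attained
  (the first one provided that the feasible set is nonempty), so they are indeed minima.
\<close>

definition optimal_value ::
    "(real^'n \<Rightarrow> real) \<Rightarrow> real^'n^'p \<Rightarrow> real^'p \<Rightarrow> (real^'n) set \<Rightarrow> real" where
  "optimal_value f G g U = (INF u\<in>{u \<in> U. G *v u + g = 0}. f u)"

definition lagrangian ::
    "(real^'n \<Rightarrow> real) \<Rightarrow> real^'n^'p \<Rightarrow> real^'p \<Rightarrow> real^'n \<Rightarrow> real^'p \<Rightarrow> real" where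
  "lagrangian f G g u x = f u - x \<bullet> (G *v u + g)"

definition dual_function ::
    "(real^'n \<Rightarrow> real) \<Rightarrow> real^'n^'p \<Rightarrow> real^'p \<Rightarrow> (real^'n) set \<Rightarrow> real^'p \<Rightarrow> real" where
  "dual_function f G g U x = (INF u\<in>U. lagrangian f G g u x)"

definition optimal_multipliers ::
    "(real^'n \<Rightarrow> real) \<Rightarrow> real^'n^'p \<Rightarrow> real^'p \<Rightarrow> (real^'n) set \<Rightarrow> (real^'p) set" where
  "optimal_multipliers f G g U =
     {x. \<forall>y. dual_function f G g U y \<le> dual_function f G g U x}"

definition gradient :: "('a::real_inner \<Rightarrow> real) \<Rightarrow> 'a \<Rightarrow> 'a" where
  "gradient h x = (THE D. GDERIV h x :> D)"

text \<open>The norm of \<open>G\<close> is the spectral norm, i.e. the operator norm for Euclidean norms.\<close>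

definition dual_lipschitz_const :: "real^'n^'p \<Rightarrow> real \<Rightarrow> real" where
  "dual_lipschitz_const G \<sigma> = (onorm ((*v) G))\<^sup>2 / \<sigma>"

definition dual_gradient_iterates ::
    "(real^'n \<Rightarrow> real) \<Rightarrow> real \<Rightarrow> real^'n^'p \<Rightarrow> real^'p \<Rightarrow> (real^'n) set \<Rightarrow> real^'p
       \<Rightarrow> (nat \<Rightarrow> real^'p) \<Rightarrow> (nat \<Rightarrow> real^'n) \<Rightarrow> bool" where
  "dual_gradient_iterates f \<sigma> G g U x0 x u \<longleftrightarrow>
     x 0 = x0 \<and>
     (\<forall>k. is_arg_min (\<lambda>v. lagrangian f G g v (x k)) (\<lambda>v. v \<in> U) (u k) \<and>
          x (Suc k) = x k + (1 / dual_lipschitz_const G \<sigma>) *\<^sub>R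
                              gradient (dual_function f G g U) (x k))"

text \<open>
  An \<open>\<epsilon>\<close>-primal solution, with the constant hidden in \<open>O(\<epsilon>)\<close> made explicit as \<open>C\<close>.
\<close>

definition primal_solution ::
    "(real^'n \<Rightarrow> real) \<Rightarrow> real^'n^'p \<Rightarrow> real^'p \<Rightarrow> (real^'n) set
       \<Rightarrow> real \<Rightarrow> real \<Rightarrow> real^'n \<Rightarrow> bool" where
  "primal_solution f G g U C \<epsilon> v \<longleftrightarrow>
     v \<in> U \<and>
     norm (G *v v + g) \<le> C * \<epsilon> \<and>
     - C * \<epsilon> \<le> f v - optimal_value f G g U \<and>
     f v - optimal_value f G g U \<le> C * \<epsilon>"

end

theory Submission
  imports Defs
begin

text \<open>
  Strong convexity makes the dual function \<open>d\<close> concave and \<open>L\<close>-smooth, with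
  \<open>L = \<parallel>G\<parallel>\<^sup>2 / \<sigma>\<close> and gradient \<open>- (G u(x) + g)\<close>. The gradient of the dual function at the
  iterate \<open>x\<^sup>k\<close> is therefore the negated constraint residual of \<open>u\<^sup>k\<close>, and algorithm (DG) is
  gradient ascent on \<open>d\<close> with step size \<open>1/L\<close>. The theorem reduces to the statement that
  gradient ascent on a smooth concave function drives the norm of the \<^emph>\<open>gradient at the last
  iterate\<close> to zero at the rate \<open>O(1/k)\<close>.

  That rate comes from the potential
  \<open>\<parallel>x\<^sup>k - x\<^sup>*\<parallel>\<^sup>2 + (2/L) k (d\<^sup>* - d(x\<^sup>k)) + k (k - 1) / (2 L\<^sup>2) \<parallel>\<nabla>d(x\<^sup>k)\<parallel>\<^sup>2\<close>, which never
  increases (lemma \<open>ascent_potential\<close>). Its three terms are linked as follows: a step shrinks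
  the squared distance by at least \<open>(2/L) (d\<^sup>* - d(x\<^sup>k\<^sup>+\<^sup>1))\<close>, which pays for raising the weight
  of the optimality gap from \<open>k\<close> to \<open>k + 1\<close>; the step also shrinks the gap itself by at least
  \<open>\<parallel>\<nabla>d(x\<^sup>k)\<parallel>\<^sup>2 / (2 L)\<close>, which pays for raising the weight of the squared gradient norm; and
  the gradient norm does not grow, because the gradient of a smooth concave function is
  cocoercive. Bounding the potential at \<open>k\<close> by its value at \<open>0\<close> bounds the gradient by
  \<open>O(1/k)\<close> and keeps the multipliers in a ball around \<open>x\<^sup>*\<close>.

  Both primal estimates follow from the residual. A maximizer \<open>x\<^sup>*\<close> of \<open>d\<close> has gradient zero, so
  \<open>u(x\<^sup>*)\<close> is feasible, hence optimal, and \<open>d(x\<^sup>*) = f\<^sup>*\<close>. Since \<open>u\<^sup>k\<close> minimizes the Lagrangian at \<open>x\<^sup>k\<close>, the gap \<open>f(u\<^sup>k) - f\<^sup>*\<close> is at most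
  \<open>\<langle>x\<^sup>k, G u\<^sup>k + g\<rangle>\<close>; since \<open>u(x\<^sup>*)\<close> minimizes it at \<open>x\<^sup>*\<close>, the gap is at least
  \<open>\<langle>x\<^sup>*, G u\<^sup>k + g\<rangle>\<close>.
\<close>

section \<open>Minimizers of strongly convex functions\<close>

lemma strongly_convex_convex_on:
  assumes "\<sigma> > 0" and "strongly_convex \<sigma> f"
  shows "convex_on UNIV f"
proof (rule convex_onI)
  fix t :: real and u v
  assume "0 < t" "t < 1"
  then have "f ((1 - t) *\<^sub>R u + t *\<^sub>R v)
      \<le> (1 - t) * f u + t * f v - \<sigma> / 2 * t * (1 - t) * (norm (u - v))\<^sup>2"
    using assms(2) unfolding strongly_convex_def by auto
  moreover have "0 \<le> \<sigma> / 2 * t * (1 - t) * (norm (u - v))\<^sup>2"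
    using assms(1) \<open>0 < t\<close> \<open>t < 1\<close> by simp
  ultimately show "f ((1 - t) *\<^sub>R u + t *\<^sub>R v) \<le> (1 - t) * f u + t * f v"
    by linarith
qed simp

text \<open>
  The modulus \<open>\<sigma>\<close> makes the function grow quadratically away from any point \<open>u\<^sub>0\<close> of the set:
  compare the value at \<open>v\<close> with a lower bound on the unit ball around \<open>u\<^sub>0\<close>, at the point where
  the segment from \<open>u\<^sub>0\<close> to \<open>v\<close> leaves that ball. The search for a minimizer is thereby confined
  to a compact set.
\<close>

lemma strongly_convex_minimizer_exists:
  fixes f :: "'a::euclidean_space \<Rightarrow> real"
  assumes \<sigma>: "\<sigma> > 0" and sc: "strongly_convex \<sigma> f" and U: "U \<noteq> {}" "closed U"
  obtains u where "is_arg_min f (\<lambda>v. v \<in> U) u"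
proof -
  have cont: "continuous_on UNIV f"
    using convex_on_continuous strongly_convex_convex_on[OF \<sigma> sc] by blast
  obtain u0 where u0: "u0 \<in> U" using U by blast
  obtain w where w: "\<And>v. v \<in> cball u0 1 \<Longrightarrow> f w \<le> f v"
    using continuous_attains_inf[of "cball u0 1" f] continuous_on_subset[OF cont]
    by (metis UNIV_I cball_eq_empty compact_cball not_one_less_zero subsetI)
  \<comment> \<open>The radius beyond which the quadratic growth outweighs the largest possible linear descent
    from \<open>f u0\<close> towards \<open>f w\<close>.\<close>
  define B where "B = 1 + 2 * (f u0 - f w) / \<sigma>"
  have "f w \<le> f u0" using w by simp
  then have B1: "B \<ge> 1" using \<sigma> unfolding B_def by simp
  have far: "f v > f u0" if "norm (v - u0) > B" for v
  proof -
    define R where "R = norm (v - u0)"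
    have R: "R > B" "R > 1" using that B1 unfolding R_def by auto
    let ?p = "(1 - 1 / R) *\<^sub>R u0 + (1 / R) *\<^sub>R v"
    have "?p - u0 = (1 / R) *\<^sub>R (v - u0)" by (simp add: algebra_simps)
    moreover have "v \<noteq> u0" using R by (auto simp: R_def)
    ultimately have "norm (?p - u0) = 1" by (simp add: R_def)
    then have "f w \<le> f ?p"
      by (intro w) (simp add: dist_norm norm_minus_commute)
    also have "1 / R \<in> {0..1}" using R by simp
    then have "f ?p \<le> (1 - 1 / R) * f u0 + 1 / R * f v
        - \<sigma> / 2 * (1 / R) * (1 - 1 / R) * (norm (u0 - v))\<^sup>2"
      using sc unfolding strongly_convex_def by blast
    also have "norm (u0 - v) = R" by (simp add: R_def norm_minus_commute)
    finally have "R * f w \<le> R * ((1 - 1 / R) * f u0 + 1 / R * f v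
        - \<sigma> / 2 * (1 / R) * (1 - 1 / R) * R\<^sup>2)"
      using R by (intro mult_left_mono) auto
    also have "\<dots> = (R - 1) * f u0 + f v - \<sigma> / 2 * (R - 1) * R"
      using R by (simp add: field_simps power2_eq_square)
    finally have ineq: "f v - f u0 \<ge> R * (\<sigma> / 2 * (R - 1) - (f u0 - f w))"
      by (simp add: algebra_simps)
    have "\<sigma> / 2 * (B - 1) = f u0 - f w" using \<sigma> by (simp add: B_def)
    moreover have "\<sigma> / 2 * (R - 1) > \<sigma> / 2 * (B - 1)" using R \<sigma> by simp
    ultimately have "R * (\<sigma> / 2 * (R - 1) - (f u0 - f w)) > 0"
      using R by simp
    then show ?thesis using ineq by linarith
  qed
  have "compact (U \<inter> cball u0 B)" using U by (simp add: closed_Int_compact)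
  moreover have "u0 \<in> U \<inter> cball u0 B" using u0 B1 by simp
  ultimately obtain u where u: "u \<in> U \<inter> cball u0 B" "\<And>v. v \<in> U \<inter> cball u0 B \<Longrightarrow> f u \<le> f v"
    using continuous_attains_inf[of "U \<inter> cball u0 B" f] continuous_on_subset[OF cont]
    by (metis empty_iff subset_UNIV)
  have "f u \<le> f v" if "v \<in> U" for v
  proof (cases "norm (v - u0) \<le> B")
    case True
    then show ?thesis using that by (intro u) (simp add: dist_norm norm_minus_commute)
  next
    case False
    then have "f u0 < f v" by (intro far) simp
    moreover have "f u \<le> f u0" using u0 B1 by (intro u) simp
    ultimately show ?thesis by simp
  qed
  then have "is_arg_min f (\<lambda>v. v \<in> U) u"
    using u(1) by (auto simp: is_arg_min_linorder)
  then show ?thesis by (rule that)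
qed

text \<open>
  On the segment from a minimizer \<open>u\<close> to \<open>v\<close>, minimality says \<open>f u \<le> f ((1 - t) u + t v)\<close>;
  inserting the strong convexity inequality, dividing by \<open>t\<close> and letting \<open>t\<close> tend to \<open>0\<close> gives
  the full modulus \<open>\<sigma> / 2\<close>.
\<close>

lemma strongly_convex_growth_at_minimizer:
  assumes sc: "strongly_convex \<sigma> f" and U: "convex U"
    and u: "is_arg_min f (\<lambda>v. v \<in> U) u" and v: "v \<in> U"
  shows "f u + \<sigma> / 2 * (norm (v - u))\<^sup>2 \<le> f v"
proof -
  have uU: "u \<in> U" and umin: "\<And>w. w \<in> U \<Longrightarrow> f u \<le> f w"
    using u by (auto simp: is_arg_min_linorder)
  have bound: "\<sigma> / 2 * (1 - t) * (norm (v - u))\<^sup>2 \<le> f v - f u" if t: "0 < t" "t < 1" for t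
  proof -
    have "f u \<le> f ((1 - t) *\<^sub>R u + t *\<^sub>R v)"
      using t by (intro umin convexD[OF U uU v]) auto
    also have "\<dots> \<le> (1 - t) * f u + t * f v - \<sigma> / 2 * t * (1 - t) * (norm (u - v))\<^sup>2"
      using sc t unfolding strongly_convex_def by auto
    finally have "t * (\<sigma> / 2 * (1 - t) * (norm (v - u))\<^sup>2) \<le> t * (f v - f u)"
      by (simp add: algebra_simps norm_minus_commute)
    then show ?thesis using t by simp
  qed
  have "((\<lambda>t. \<sigma> / 2 * (1 - t) * (norm (v - u))\<^sup>2) \<longlongrightarrow> \<sigma> / 2 * (1 - 0) * (norm (v - u))\<^sup>2)
      (at_right (0::real))"
    by (intro tendsto_intros)
  moreover have "\<forall>\<^sub>F t in at_right (0::real). \<sigma> / 2 * (1 - t) * (norm (v - u))\<^sup>2 \<le> f v - f u"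
    using bound by (auto simp: eventually_at_right[of 0 "1::real"] intro!: exI[of _ "1::real"])
  ultimately have "\<sigma> / 2 * (1 - 0) * (norm (v - u))\<^sup>2 \<le> f v - f u"
    by (intro tendsto_upperbound) auto
  then show ?thesis by simp
qed

section \<open>Smoothness of the dual function\<close>

lemma strongly_convex_lagrangian:
  assumes "strongly_convex \<sigma> f"
  shows "strongly_convex \<sigma> (\<lambda>v. lagrangian f G g v x)"
  unfolding strongly_convex_def
proof (intro allI ballI)
  fix u v and t :: real
  assume t: "t \<in> {0..1}"
  have "f ((1 - t) *\<^sub>R u + t *\<^sub>R v)
      \<le> (1 - t) * f u + t * f v - \<sigma> / 2 * t * (1 - t) * (norm (u - v))\<^sup>2"
    using assms t unfolding strongly_convex_def by blast
  moreover have "x \<bullet> (G *v ((1 - t) *\<^sub>R u + t *\<^sub>R v) + g)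
      = (1 - t) * (x \<bullet> (G *v u + g)) + t * (x \<bullet> (G *v v + g))"
    by (simp add: matrix_vector_right_distrib matrix_vector_mult_scaleR
        inner_add_right algebra_simps)
  ultimately show "lagrangian f G g ((1 - t) *\<^sub>R u + t *\<^sub>R v) x
      \<le> (1 - t) * lagrangian f G g u x + t * lagrangian f G g v x
        - \<sigma> / 2 * t * (1 - t) * (norm (u - v))\<^sup>2"
    unfolding lagrangian_def by (simp add: algebra_simps)
qed

lemma lagrangian_change_multiplier:
  "lagrangian f G g u y = lagrangian f G g u x - (y - x) \<bullet> (G *v u + g)"
  by (simp add: lagrangian_def inner_diff_left)

lemma dual_function_eq_lagrangian:
  assumes "is_arg_min (\<lambda>v. lagrangian f G g v x) (\<lambda>v. v \<in> U) u"
  shows "dual_function f G g U x = lagrangian f G g u x"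
  unfolding dual_function_def using assms
  by (intro cInf_eq_minimum) (auto simp: is_arg_min_linorder)

lemma dual_lipschitz_const_pos:
  fixes G :: "real^'n^'p"
  assumes "\<sigma> > 0" and "G \<noteq> 0"
  shows "dual_lipschitz_const G \<sigma> > 0"
proof -
  have "\<exists>v. G *v v \<noteq> 0"
    using assms(2) matrix_eq[of G 0] by auto
  then have "onorm ((*v) G) > 0"
    by (simp add: onorm_pos_lt)
  then show ?thesis using assms(1) by (simp add: dual_lipschitz_const_def)
qed

text \<open>
  The minimizer at \<open>x\<close> is a candidate in the minimum defining the dual function at \<open>y\<close>.
\<close>

lemma dual_function_upper_bound:
  assumes ux: "is_arg_min (\<lambda>v. lagrangian f G g v x) (\<lambda>v. v \<in> U) ux"
    and uy: "is_arg_min (\<lambda>v. lagrangian f G g v y) (\<lambda>v. v \<in> U) uy"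
  shows "dual_function f G g U y \<le> dual_function f G g U x + (y - x) \<bullet> - (G *v ux + g)"
proof -
  have "lagrangian f G g uy y \<le> lagrangian f G g ux y"
    using ux uy by (auto simp: is_arg_min_linorder)
  then show ?thesis
    using dual_function_eq_lagrangian[OF ux] dual_function_eq_lagrangian[OF uy]
    by (simp add: lagrangian_change_multiplier[of f G g ux y x] del: minus_add_distrib)
qed

text \<open>
  Moving the multiplier from \<open>x\<close> to \<open>y\<close> moves the minimizer by some \<open>e\<close>. Quadratic growth of the
  Lagrangian at \<open>x\<close> charges \<open>\<sigma> / 2 * \<parallel>e\<parallel>\<^sup>2\<close> for that move, and the gain from it is at most
  \<open>\<parallel>y - x\<parallel> \<parallel>G\<parallel> \<parallel>e\<parallel>\<close>; the best trade-off over \<open>\<parallel>e\<parallel>\<close> is the smoothness term.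
\<close>

lemma dual_function_lower_bound:
  fixes f :: "real^'n \<Rightarrow> real" and G :: "real^'n^'p"
  assumes \<sigma>: "\<sigma> > 0" and sc: "strongly_convex \<sigma> f" and U: "convex U"
    and ux: "is_arg_min (\<lambda>v. lagrangian f G g v x) (\<lambda>v. v \<in> U) ux"
    and uy: "is_arg_min (\<lambda>v. lagrangian f G g v y) (\<lambda>v. v \<in> U) uy"
  shows "dual_function f G g U y \<ge> dual_function f G g U x + (y - x) \<bullet> - (G *v ux + g)
           - dual_lipschitz_const G \<sigma> / 2 * (norm (y - x))\<^sup>2"
proof -
  define e where "e = uy - ux"
  define a where "a = norm (y - x) * onorm ((*v) G)"
  have "uy \<in> U" using uy by (simp add: is_arg_min_def)
  then have growth: "lagrangian f G g ux x + \<sigma> / 2 * (norm e)\<^sup>2 \<le> lagrangian f G g uy x"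
    unfolding e_def
    by (rule strongly_convex_growth_at_minimizer[OF strongly_convex_lagrangian[OF sc] U ux])
  have "(y - x) \<bullet> (G *v e) \<le> norm (y - x) * norm (G *v e)"
    by (rule norm_cauchy_schwarz)
  also have "\<dots> \<le> norm (y - x) * (onorm ((*v) G) * norm e)"
    by (intro mult_left_mono onorm) auto
  finally have cs: "(y - x) \<bullet> (G *v e) \<le> a * norm e"
    by (simp add: a_def mult.assoc)
  have "0 \<le> (\<sigma> * norm e - a)\<^sup>2 / (2 * \<sigma>)" using \<sigma> by simp
  also have "\<dots> = \<sigma> / 2 * (norm e)\<^sup>2 - a * norm e + a\<^sup>2 / (2 * \<sigma>)"
    using \<sigma> by (simp add: power2_eq_square field_simps)
  finally have "a * norm e - \<sigma> / 2 * (norm e)\<^sup>2 \<le> a\<^sup>2 / (2 * \<sigma>)" by linarith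
  also have "a\<^sup>2 / (2 * \<sigma>) = dual_lipschitz_const G \<sigma> / 2 * (norm (y - x))\<^sup>2"
    by (simp add: a_def dual_lipschitz_const_def power_mult_distrib mult.commute)
  finally have young: "a * norm e - \<sigma> / 2 * (norm e)\<^sup>2
      \<le> dual_lipschitz_const G \<sigma> / 2 * (norm (y - x))\<^sup>2" .
  have "G *v uy + g = G *v ux + g + G *v e"
    by (simp add: e_def matrix_vector_mult_diff_distrib)
  then have "lagrangian f G g uy y
      = lagrangian f G g uy x - (y - x) \<bullet> (G *v ux + g) - (y - x) \<bullet> (G *v e)"
    by (simp add: lagrangian_change_multiplier[of f G g uy y x] inner_add_right)
  then show ?thesis
    using growth cs young dual_function_eq_lagrangian[OF ux] dual_function_eq_lagrangian[OF uy]
    by (simp del: minus_add_distrib)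
qed

lemma GDERIV_of_quadratic_bounds:
  fixes h :: "'a::real_inner \<Rightarrow> real"
  assumes upper: "\<And>y. h y \<le> h x + (y - x) \<bullet> D"
    and lower: "\<And>y. h y \<ge> h x + (y - x) \<bullet> D - c * (norm (y - x))\<^sup>2"
  shows "GDERIV h x :> D"
  unfolding gderiv_def
proof (rule has_derivativeI_sandwich[of 1 _ UNIV x h "\<lambda>y. c * norm (y - x)"])
  show "bounded_linear (\<lambda>v. v \<bullet> D)" by (rule bounded_linear_inner_left)
  show "norm (h y - h x - (y - x) \<bullet> D) / norm (y - x) \<le> c * norm (y - x)"
    if "y \<in> UNIV" "y \<noteq> x" "dist y x < 1" for y
  proof -
    have "norm (h y - h x - (y - x) \<bullet> D) \<le> c * (norm (y - x))\<^sup>2"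
      using upper[of y] lower[of y] by simp
    then show ?thesis
      using that by (simp add: field_simps power2_eq_square)
  qed
  have "((\<lambda>y. c * norm (y - x)) \<longlongrightarrow> c * norm (x - x)) (at x)"
    by (intro tendsto_intros)
  then show "((\<lambda>y. c * norm (y - x)) \<longlongrightarrow> 0) (at x)" by simp
qed simp

lemma gradient_eqI:
  assumes "GDERIV h x :> D"
  shows "gradient h x = D"
  unfolding gradient_def
proof (rule the_equality[of "\<lambda>D. GDERIV h x :> D", OF assms])
  fix D' assume "GDERIV h x :> D'"
  then have "(\<lambda>v. v \<bullet> D') = (\<lambda>v. v \<bullet> D)"
    using assms has_derivative_unique unfolding gderiv_def by blast
  then show "D' = D" by (metis vector_eq_ldot)
qed

section \<open>Gradient ascent on a smooth concave function\<close>

text \<open>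
  Concavity and smoothness enter only through two global bounds: \<open>s\<close> is a supergradient of \<open>d\<close>,
  and \<open>d\<close> exceeds a paraboloid of curvature \<open>L\<close> touching it at each point. They make \<open>s\<close> the
  gradient field of \<open>d\<close>.
\<close>

context
  fixes d :: "'a::real_inner \<Rightarrow> real" and s :: "'a \<Rightarrow> 'a" and L :: real
  assumes L: "L > 0"
    and supergradient: "\<And>x y. d y \<le> d x + (y - x) \<bullet> s x"
    and smooth: "\<And>x y. d y \<ge> d x + (y - x) \<bullet> s x - L / 2 * (norm (y - x))\<^sup>2"
begin

lemma ascent_step_gain:
  "d (x + (1 / L) *\<^sub>R s x) \<ge> d x + (norm (s x))\<^sup>2 / (2 * L)"
proof -
  have "(norm (s x))\<^sup>2 / (2 * L) = (norm (s x))\<^sup>2 / L - L / 2 * (norm ((1 / L) *\<^sub>R s x))\<^sup>2"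
    using L by (simp add: power_mult_distrib power_divide power2_eq_square[of L])
  then show ?thesis
    using smooth[of x "x + (1 / L) *\<^sub>R s x"] by (simp add: dot_square_norm)
qed

lemma gradient_at_maximizer:
  assumes "\<And>y. d y \<le> d x"
  shows "s x = 0"
proof -
  have "(norm (s x))\<^sup>2 / (2 * L) \<le> 0"
    using ascent_step_gain[of x] assms[of "x + (1 / L) *\<^sub>R s x"] by linarith
  then show ?thesis
    using L by (simp add: divide_le_0_iff power2_eq_square mult_le_0_iff)
qed

text \<open>
  The linear upper bound at \<open>x\<close> and the paraboloid at \<open>y\<close> are compared at the point
  \<open>z = y + (s y - s x) / L\<close>, where the paraboloid rises furthest relative to the linear bound.
\<close>

lemma supergradient_with_remainder:
  "d y \<le> d x + (y - x) \<bullet> s x - (norm (s y - s x))\<^sup>2 / (2 * L)"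
proof -
  define w where "w = s y - s x"
  define z where "z = y + (1 / L) *\<^sub>R w"
  have "d y + (z - y) \<bullet> s y - L / 2 * (norm (z - y))\<^sup>2 \<le> d x + (z - x) \<bullet> s x"
    using smooth[of y z] supergradient[of z x] by linarith
  moreover have "(z - x) \<bullet> s x = (z - y) \<bullet> s x + (y - x) \<bullet> s x"
    by (simp add: algebra_simps)
  moreover have "(z - y) \<bullet> s y - (z - y) \<bullet> s x = (norm w)\<^sup>2 / L"
  proof -
    have "(z - y) \<bullet> s y - (z - y) \<bullet> s x = (z - y) \<bullet> w"
      by (simp add: w_def inner_diff_right)
    also have "\<dots> = (norm w)\<^sup>2 / L" by (simp add: z_def dot_square_norm)
    finally show ?thesis .
  qed
  moreover have "L / 2 * (norm (z - y))\<^sup>2 = (norm w)\<^sup>2 / (2 * L)"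
    using L by (simp add: z_def power_mult_distrib field_simps power2_eq_square)
  moreover have "(norm w)\<^sup>2 / L = (norm w)\<^sup>2 / (2 * L) + (norm w)\<^sup>2 / (2 * L)"
    by simp
  ultimately show ?thesis unfolding w_def by linarith
qed

text \<open>
  Adding the sharpened supergradient inequality for both orders of two points gives
  cocoercivity, \<open>\<parallel>s y - s x\<parallel>\<^sup>2 \<le> L \<langle>x - y, s y - s x\<rangle>\<close>. For a step
  \<open>y = x + s x / L\<close> this collapses to \<open>\<parallel>s y\<parallel>\<^sup>2 \<le> \<langle>s x, s y\<rangle>\<close>.
\<close>

lemma ascent_gradient_norm_decreasing:
  "norm (s (x + (1 / L) *\<^sub>R s x)) \<le> norm (s x)"
proof -
  define y where "y = x + (1 / L) *\<^sub>R s x"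
  have "(norm (s y - s x))\<^sup>2 / (2 * L) + (norm (s x - s y))\<^sup>2 / (2 * L)
      \<le> (y - x) \<bullet> s x + (x - y) \<bullet> s y"
    using supergradient_with_remainder[of y x] supergradient_with_remainder[of x y] by linarith
  also have "\<dots> = (s x \<bullet> s x - s x \<bullet> s y) / L"
    by (simp add: y_def diff_divide_distrib)
  finally have "(norm (s y - s x))\<^sup>2 \<le> s x \<bullet> s x - s x \<bullet> s y"
    using L by (simp add: norm_minus_commute field_simps)
  then have "norm (s y) * norm (s y) \<le> s x \<bullet> s y"
    by (simp add: power2_norm_eq_inner inner_diff_left inner_diff_right inner_commute
        flip: power2_eq_square)
  also have "\<dots> \<le> norm (s x) * norm (s y)" by (rule norm_cauchy_schwarz)
  finally show ?thesis
    unfolding y_def[symmetric] by (cases "norm (s y) = 0") (auto simp: mult_le_cancel_right)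
qed

lemma ascent_step_distance:
  "(norm (x + (1 / L) *\<^sub>R s x - z))\<^sup>2
     \<le> (norm (x - z))\<^sup>2 - 2 / L * (d z - d (x + (1 / L) *\<^sub>R s x))"
proof -
  define y where "y = x + (1 / L) *\<^sub>R s x"
  have y: "y - z = (x - z) + (1 / L) *\<^sub>R s x" by (simp add: y_def)
  have "(norm (y - z))\<^sup>2
      = (norm (x - z))\<^sup>2 + 2 / L * ((x - z) \<bullet> s x) + (norm (s x))\<^sup>2 / L\<^sup>2"
    unfolding y power2_norm_eq_inner
    by (simp add: inner_add_left inner_add_right inner_commute power2_eq_square[of L])
  also have "(norm (s x))\<^sup>2 / L\<^sup>2 = 2 / L * ((norm (s x))\<^sup>2 / (2 * L))"
    by (simp add: power2_eq_square)
  also have "(norm (x - z))\<^sup>2 + 2 / L * ((x - z) \<bullet> s x) + \<dots>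
      = (norm (x - z))\<^sup>2 + 2 / L * ((x - z) \<bullet> s x + (norm (s x))\<^sup>2 / (2 * L))"
    by (simp add: distrib_left)
  also have "\<dots> \<le> (norm (x - z))\<^sup>2 + 2 / L * (d y - d z)"
  proof -
    have "(x - z) \<bullet> s x + (norm (s x))\<^sup>2 / (2 * L) \<le> d y - d z"
      using supergradient[of z x] ascent_step_gain[of x]
      by (simp add: y_def inner_diff_left)
    then show ?thesis using L by (intro add_left_mono mult_left_mono) auto
  qed
  also have "\<dots> = (norm (x - z))\<^sup>2 - 2 / L * (d z - d y)"
    by (simp add: right_diff_distrib)
  finally show ?thesis unfolding y_def .
qed

text \<open>
  The weights \<open>1\<close>, \<open>k\<close> and \<open>k (k - 1) / 2\<close> are successive sums, so that the increase of each
  weight in a step is paid for by the decrease of the preceding term.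
\<close>

lemma ascent_potential:
  assumes step: "\<And>k. x (Suc k) = x k + (1 / L) *\<^sub>R s (x k)"
  shows "(norm (x k - z))\<^sup>2 + 2 / L * (real k * (d z - d (x k)))
           + real k * (real k - 1) / (2 * L\<^sup>2) * (norm (s (x k)))\<^sup>2
         \<le> (norm (x 0 - z))\<^sup>2"
proof (induction k)
  case 0
  show ?case by simp
next
  case (Suc k)
  let ?c = "(norm (s (x k)))\<^sup>2"
  have gap: "2 / L * (real k * (?c / (2 * L))) \<le> 2 / L * (real k * (d (x (Suc k)) - d (x k)))"
    using ascent_step_gain[of "x k"] L by (intro mult_left_mono) (auto simp: step)
  have "(norm (s (x (Suc k))))\<^sup>2 \<le> ?c"
    unfolding step by (intro power_mono ascent_gradient_norm_decreasing) simp
  then have grad: "real (Suc k) * (real (Suc k) - 1) / (2 * L\<^sup>2) * (norm (s (x (Suc k))))\<^sup>2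
      \<le> real (Suc k) * (real (Suc k) - 1) / (2 * L\<^sup>2) * ?c"
    by (intro mult_left_mono) auto
  have weight: "real (Suc k) * (real (Suc k) - 1) / (2 * L\<^sup>2) * ?c
      = real k * (real k - 1) / (2 * L\<^sup>2) * ?c + 2 / L * (real k * (?c / (2 * L)))"
    using L by (simp add: field_simps power2_eq_square)
  have "(norm (x (Suc k) - z))\<^sup>2 \<le> (norm (x k - z))\<^sup>2 - 2 / L * (d z - d (x (Suc k)))"
    unfolding step by (rule ascent_step_distance)
  moreover have "2 / L * (real (Suc k) * (d z - d (x (Suc k))))
      = 2 / L * (real k * (d z - d (x k))) - 2 / L * (real k * (d (x (Suc k)) - d (x k)))
        + 2 / L * (d z - d (x (Suc k)))"
    by (simp add: algebra_simps)
  ultimately show ?case using Suc.IH gap grad weight by linarith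
qed

lemma ascent_rate:
  assumes step: "\<And>k. x (Suc k) = x k + (1 / L) *\<^sub>R s (x k)"
    and z: "\<And>y. d y \<le> d z"
  shows "norm (x k - z) \<le> norm (x 0 - z)"
    and "2 \<le> k \<Longrightarrow> norm (s (x k)) \<le> 2 * L * norm (x 0 - z) / real k"
proof -
  have gap: "2 / L * (real k * (d z - d (x k))) \<ge> 0" using L z by simp
  have grad: "real k * (real k - 1) / (2 * L\<^sup>2) * (norm (s (x k)))\<^sup>2 \<ge> 0"
    by (cases k) simp_all
  note pot = ascent_potential[of x k z, OF step]
  have "(norm (x k - z))\<^sup>2 \<le> (norm (x 0 - z))\<^sup>2" using pot gap grad by linarith
  then show "norm (x k - z) \<le> norm (x 0 - z)" by (simp add: power2_le_iff_abs_le)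
  assume k: "2 \<le> k"
  have "real k * (real k - 1) / (2 * L\<^sup>2) * (norm (s (x k)))\<^sup>2 \<le> (norm (x 0 - z))\<^sup>2"
    using pot gap zero_le_power2[of "norm (x k - z)"] by linarith
  \<comment> \<open>For \<open>k \<ge> 2\<close> the weight \<open>k (k - 1)\<close> is at least \<open>k\<^sup>2 / 2\<close>.\<close>
  moreover have "(real k)\<^sup>2 / 2 / (2 * L\<^sup>2) * (norm (s (x k)))\<^sup>2
      \<le> real k * (real k - 1) / (2 * L\<^sup>2) * (norm (s (x k)))\<^sup>2"
    using k by (intro mult_right_mono divide_right_mono) (auto simp: power2_eq_square)
  ultimately have "(real k)\<^sup>2 / 2 / (2 * L\<^sup>2) * (norm (s (x k)))\<^sup>2 \<le> (norm (x 0 - z))\<^sup>2"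
    by linarith
  then have "(real k * norm (s (x k)))\<^sup>2 \<le> (2 * L * norm (x 0 - z))\<^sup>2"
    using L by (simp add: field_simps power_mult_distrib)
  then have "real k * norm (s (x k)) \<le> 2 * L * norm (x 0 - z)"
    using L by (intro power2_le_imp_le[of "real k * norm (s (x k))"]) auto
  then show "norm (s (x k)) \<le> 2 * L * norm (x 0 - z) / real k"
    using k by (simp add: field_simps)
qed

end

section \<open>From multipliers to primal points\<close>

text \<open>
  At feasible points the Lagrangian equals the objective, so a minimizer of it over \<open>U\<close>
  that happens to be feasible solves the constrained problem.
\<close>

lemma optimal_value_at_feasible_minimizer:
  assumes "is_arg_min (\<lambda>v. lagrangian f G g v x) (\<lambda>v. v \<in> U) u" and "G *v u + g = 0"
  shows "optimal_value f G g U = f u"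
  unfolding optimal_value_def
proof (rule cInf_eq_minimum)
  show "f u \<in> f ` {u \<in> U. G *v u + g = 0}"
    using assms by (auto simp: is_arg_min_def)
  show "f u \<le> c" if c: "c \<in> f ` {u \<in> U. G *v u + g = 0}" for c
  proof -
    obtain v where v: "c = f v" "v \<in> U" "G *v v + g = 0" using c by auto
    then have "lagrangian f G g u x \<le> lagrangian f G g v x"
      using assms(1) by (auto simp: is_arg_min_linorder)
    then show ?thesis using v assms(2) by (simp add: lagrangian_def)
  qed
qed

lemma lagrangian_minimizer_suboptimality:
  assumes opt: "is_arg_min (\<lambda>v. lagrangian f G g v xopt) (\<lambda>v. v \<in> U) uopt"
    and feas: "G *v uopt + g = 0"
    and u: "is_arg_min (\<lambda>v. lagrangian f G g v x) (\<lambda>v. v \<in> U) u"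
  shows "f u - optimal_value f G g U \<le> norm x * norm (G *v u + g)"
    and "- (norm xopt * norm (G *v u + g)) \<le> f u - optimal_value f G g U"
proof -
  note val = optimal_value_at_feasible_minimizer[OF opt feas]
  have "lagrangian f G g u x \<le> lagrangian f G g uopt x"
    using opt u by (auto simp: is_arg_min_linorder)
  then have "f u - f uopt \<le> x \<bullet> (G *v u + g)" using feas by (simp add: lagrangian_def)
  also have "\<dots> \<le> norm x * norm (G *v u + g)" by (rule norm_cauchy_schwarz)
  finally show "f u - optimal_value f G g U \<le> norm x * norm (G *v u + g)" by (simp add: val)
  have "lagrangian f G g uopt xopt \<le> lagrangian f G g u xopt"
    using opt u by (auto simp: is_arg_min_linorder)
  then have "xopt \<bullet> (G *v u + g) \<le> f u - f uopt" using feas by (simp add: lagrangian_def)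
  moreover have "- (norm xopt * norm (G *v u + g)) \<le> xopt \<bullet> (G *v u + g)"
    using Cauchy_Schwarz_ineq2[of xopt "G *v u + g"] by linarith
  ultimately show "- (norm xopt * norm (G *v u + g)) \<le> f u - optimal_value f G g U"
    by (simp add: val)
qed

theorem theorem6p1:
  fixes f :: "real^'n \<Rightarrow> real" and \<sigma> :: real
    and G :: "real^'n^'p" and g :: "real^'p"
    and U :: "(real^'n) set" and x0 :: "real^'p"
  assumes "\<sigma> > 0" and "strongly_convex \<sigma> f"
    and "G \<noteq> 0"
    and "U \<noteq> {}" and "closed U" and "convex U"
    and "optimal_multipliers f G g U \<noteq> {}"
  shows "\<exists>C\<^sub>1>0. \<exists>C\<^sub>2>0. \<forall>x u. dual_gradient_iterates f \<sigma> G g U x0 x u \<longrightarrow>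
           (\<forall>\<epsilon>>0. \<forall>k::nat. k \<ge> 1 \<and> real (2 * k) \<ge> C\<^sub>1 / \<epsilon> \<longrightarrow>
              primal_solution f G g U C\<^sub>2 \<epsilon> (u (2 * k)))"
proof -
  define d where "d = dual_function f G g U"
  define L where "L = dual_lipschitz_const G \<sigma>"
  have L: "L > 0" unfolding L_def using assms by (intro dual_lipschitz_const_pos)
  have "\<exists>u. is_arg_min (\<lambda>v. lagrangian f G g v x) (\<lambda>v. v \<in> U) u" for x
    using strongly_convex_minimizer_exists[OF assms(1) strongly_convex_lagrangian[OF assms(2)]
        assms(4,5)] by metis
  then obtain m where m: "\<And>x. is_arg_min (\<lambda>v. lagrangian f G g v x) (\<lambda>v. v \<in> U) (m x)"
    by metis
  have upper: "d y \<le> d x + (y - x) \<bullet> - (G *v w + g)"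
    if "is_arg_min (\<lambda>v. lagrangian f G g v x) (\<lambda>v. v \<in> U) w" for x y w
    unfolding d_def by (rule dual_function_upper_bound[OF that m])
  have lower: "d y \<ge> d x + (y - x) \<bullet> - (G *v w + g) - L / 2 * (norm (y - x))\<^sup>2"
    if "is_arg_min (\<lambda>v. lagrangian f G g v x) (\<lambda>v. v \<in> U) w" for x y w
    unfolding d_def L_def by (rule dual_function_lower_bound[OF assms(1,2,6) that m])
  have grad: "gradient d x = - (G *v w + g)"
    if "is_arg_min (\<lambda>v. lagrangian f G g v x) (\<lambda>v. v \<in> U) w" for x w
    by (intro gradient_eqI GDERIV_of_quadratic_bounds[where c = "L / 2"] upper[OF that]
        lower[OF that])
  have upper': "d y \<le> d x + (y - x) \<bullet> gradient d x" for x y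
    unfolding grad[OF m] by (rule upper[OF m])
  have lower': "d y \<ge> d x + (y - x) \<bullet> gradient d x - L / 2 * (norm (y - x))\<^sup>2" for x y
    unfolding grad[OF m] by (rule lower[OF m])
  obtain xopt where xopt: "\<And>y. d y \<le> d xopt"
    using assms(7) unfolding optimal_multipliers_def d_def by auto
  have feas: "G *v m xopt + g = 0"
    using gradient_at_maximizer[of L d "gradient d", OF L upper' lower' xopt] grad[OF m, of xopt]
    by (metis neg_equal_0_iff_equal)
  define R where "R = norm (x0 - xopt)"
  define K where "K = 2 * L * R"
  \<comment> \<open>\<open>B\<close> dominates the three factors by which the residual is multiplied: \<open>1\<close> for feasibility,
    \<open>norm (x (2 * k))\<close> and \<open>norm xopt\<close> for the two sides of the suboptimality. The summand \<open>1\<close>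
    of \<open>C\<close> keeps it positive when \<open>x0 = xopt\<close>.\<close>
  define B where "B = 1 + R + norm xopt"
  define C where "C = K * B + 1"
  have K: "K \<ge> 0" using L by (simp add: K_def R_def)
  have B: "B \<ge> 1" by (simp add: B_def R_def)
  have C: "C > 0" using K B by (simp add: C_def add_nonneg_pos)
  have sol: "primal_solution f G g U C \<epsilon> (u (2 * k))"
    if iter: "dual_gradient_iterates f \<sigma> G g U x0 x u" and \<epsilon>: "\<epsilon> > 0"
      and k: "k \<ge> 1" "real (2 * k) \<ge> 1 / \<epsilon>" for x u \<epsilon> k
  proof -
    have x0: "x 0 = x0" and step: "\<And>j. x (Suc j) = x j + (1 / L) *\<^sub>R gradient d (x j)"
      using iter unfolding dual_gradient_iterates_def d_def L_def by auto
    have u: "is_arg_min (\<lambda>v. lagrangian f G g v (x (2 * k))) (\<lambda>v. v \<in> U) (u (2 * k))"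
      using iter unfolding dual_gradient_iterates_def by blast
    define r where "r = norm (G *v u (2 * k) + g)"
    have "gradient d (x (2 * k)) = - (G *v u (2 * k) + g)" by (rule grad[OF u])
    then have r: "r = norm (gradient d (x (2 * k)))" unfolding r_def by (metis norm_minus_cancel)
    note rate = ascent_rate[of L d "gradient d" x xopt "2 * k", OF L upper' lower' step xopt]
    have "r \<le> K / real (2 * k)" using rate(2) k unfolding r K_def R_def x0 by simp
    also have "\<dots> = K * (1 / real (2 * k))" by simp
    also have "\<dots> \<le> K * \<epsilon>"
    proof (intro mult_left_mono K)
      show "1 / real (2 * k) \<le> \<epsilon>" using k \<epsilon> by (simp add: field_simps)
    qed
    finally have rK: "r \<le> K * \<epsilon>" .
    have bound: "c * r \<le> C * \<epsilon>" if "0 \<le> c" "c \<le> B" for c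
    proof -
      have "c * r \<le> B * (K * \<epsilon>)" using that rK by (intro mult_mono) (auto simp: r_def)
      also have "\<dots> \<le> C * \<epsilon>" using \<epsilon> by (simp add: C_def algebra_simps)
      finally show ?thesis .
    qed
    have "norm (x (2 * k)) \<le> norm (x (2 * k) - xopt) + norm xopt"
      using norm_triangle_ineq[of "x (2 * k) - xopt" xopt] by simp
    then have xk: "norm (x (2 * k)) \<le> B" using rate(1) unfolding B_def R_def x0 by simp
    have "f (u (2 * k)) - optimal_value f G g U \<le> norm (x (2 * k)) * r"
      and "- (norm xopt * r) \<le> f (u (2 * k)) - optimal_value f G g U"
      unfolding r_def by (rule lagrangian_minimizer_suboptimality[OF m feas u])+
    moreover have "norm (x (2 * k)) * r \<le> C * \<epsilon>" using xk by (intro bound) auto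
    moreover have "norm xopt * r \<le> C * \<epsilon>" by (intro bound) (auto simp: B_def R_def)
    moreover have "1 * r \<le> C * \<epsilon>" using B by (intro bound) auto
    moreover have "u (2 * k) \<in> U" using u by (simp add: is_arg_min_def)
    ultimately show ?thesis unfolding primal_solution_def r_def[symmetric] by simp
  qed
  show ?thesis
  proof (intro exI conjI allI impI)
    show "(1::real) > 0" by simp
    show "C > 0" by (rule C)
  qed (use sol in auto)
qed

end
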